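(* Let $F=f+r$ with $f=\frac1n\sum_{i=1}^n f_i:\mathbb{R}^d\to\mathbb{R}$, where each $f_i$ is $L$-smooth, $f$ is convex, and $r:\mathbb{R}^d\to\mathbb{R}$ is convex (possibly non-smooth). Let $\mathbf{x}^*$ be a minimizer of $F$, and let $\mathbf{x}_0\in\mathbb{R}^d$ satisfy $F(\mathbf{x}_0)-F(\mathbf{x}^* )\le\Delta$ and $\|\mathbf{x}_0-\mathbf{x}^*\|^2\le\Theta$. Let $\mathcal{A}$ be an algorithm satisfying the ZOOD property with constants $\delta_\mu$, $\mathcal{K}\in(0,1)$, $\mathcal{E}\ge 0$, and let $\mathbf{x}_S$ be the output of the AdaptRdct-C framework run for $S$ stages from $\mathbf{x}_0$ with initial coefficient $\gamma_0>0$, discount coefficient $\mathcal{K}$ and inner solver $\mathcal{A}$. Then $$\mathbb{E}[F(\mathbf{x}_S)-F(\mathbf{x}^* )]\le \delta_\mu+\mathcal{K}^S[\Delta-\delta_\mu]+\left(\frac12+\frac{2}{\sqrt{\mathcal{K}}}\right)\mathcal{K}^{S/2}\gamma_0\Theta+\frac{\mathcal{E}}{1-\mathcal{K}}.$$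
   Context: $\|\cdot\|$ is the Euclidean norm. A function $g$ is $L$-smooth if it has continuous gradient and $|g(\mathbf{y})-g(\mathbf{x})-\langle\nabla g(\mathbf{x}),\mathbf{y}-\mathbf{x}\rangle|\le\frac L2\|\mathbf{y}-\mathbf{x}\|^2$ for all $\mathbf{x},\mathbf{y}$. ZOOD property (Zeroth-Order Objective Decrease): a (randomized) algorithm $\mathcal{A}(F,\mathbf{x})$ for minimizing $F$ satisfies the ZOOD property if, for any starting point $\mathbf{x}_0$, it produces an output $\mathbf{x}'\leftarrow\mathcal{A}(F,\mathbf{x}_0)$ with $$\mathbb{E}\left[F(\mathbf{x}')-\min_{\mathbf{x}}F(\mathbf{x})-\delta_\mu\right]\le\mathcal{K}\left[F(\mathbf{x}_0)-\min_{\mathbf{x}}F(\mathbf{x})-\delta_\mu\right]+\mathcal{E},$$ where $\delta_\mu$ is a fixed error, $0<\mathcal{K}<1$, and $\mathcal{E}$ is a constant error. The expectation is over the internal randomness of $\mathcal{A}$; the constants $\delta_\mu,\mathcal{K},\mathcal{E}$ are the same for all objectives (here $F^{(\gamma_s)}$, $s=0,1,\dots$) to which $\mathcal{A}$ is applied. When $\mathcal{A}$ is started at a random point, fresh randomness is used and the inequality holds conditionally on the starting point. AdaptRdct-C: for $s=0,1,\dots,S-1$, set $F^{(\gamma_s)}(\mathbf{x})=F(\mathbf{x})+\frac{\gamma_s}{2}\|\mathbf{x}-\mathbf{x}_0\|^2$, $\mathbf{x}_{s+1}\leftarrow\mathcal{A}(F^{(\gamma_s)},\mathbf{x}_s)$,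 $\gamma_{s+1}=\sqrt{\mathcal{K}}\,\gamma_s$. Output $\mathbf{x}_S$. *)

theory Defs
  imports "HOL-Analysis.Analysis" "HOL-Probability.Probability"
begin

definition L_smooth :: "real \<Rightarrow> ('a::real_inner \<Rightarrow> real) \<Rightarrow> bool" where
  "L_smooth L g \<longleftrightarrow>
     (\<exists>grad. (\<forall>x. GDERIV g x :> grad x) \<and> continuous_on UNIV grad \<and>
       (\<forall>x y. \<bar>g y - g x - grad x \<bullet> (y - x)\<bar> \<le> L / 2 * (norm (y - x))\<^sup>2))"

text \<open>A literal minimum rather than an infimum: unspecified if \<open>G\<close> attains no minimum.\<close>

definition min_val :: "('a \<Rightarrow> real) \<Rightarrow> real" where
  "min_val G = (LEAST v. v \<in> range G)"

text \<open>
  A randomized algorithm takes an objective and a starting point to the law of its output.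
\<close>

type_synonym 'a rand_alg = "('a \<Rightarrow> real) \<Rightarrow> 'a \<Rightarrow> 'a measure"

text \<open>
  For each objective, \<open>A\<close> has to be a Markov kernel, so that it can be started at a random
  point. Integrability is required explicitly because the integral of a non-integrable function
  is \<open>0\<close> in HOL, which would make the inequality meaningless.
\<close>

definition ZOOD ::
  "'a::topological_space rand_alg \<Rightarrow> ('a \<Rightarrow> real) set \<Rightarrow> real \<Rightarrow> real \<Rightarrow> real \<Rightarrow> bool" where
  "ZOOD A objs \<delta> K E \<longleftrightarrow>
     0 < K \<and> K < 1 \<and>
     (\<forall>G\<in>objs.
        A G \<in> borel \<rightarrow>\<^sub>M prob_algebra borel \<and>
        (\<forall>x. integrable (A G x) (\<lambda>x'. G x' - min_val G - \<delta>) \<and>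
             (\<integral>x'. (G x' - min_val G - \<delta>) \<partial>A G x) \<le> K * (G x - min_val G - \<delta>) + E))"

definition reg_obj ::
  "('a::real_normed_vector \<Rightarrow> real) \<Rightarrow> 'a \<Rightarrow> real \<Rightarrow> 'a \<Rightarrow> real" where
  "reg_obj F x0 \<gamma> x = F x + \<gamma> / 2 * (norm (x - x0))\<^sup>2"

primrec reg_coeff :: "real \<Rightarrow> real \<Rightarrow> nat \<Rightarrow> real" where
  "reg_coeff K \<gamma>0 0 = \<gamma>0"
| "reg_coeff K \<gamma>0 (Suc s) = sqrt K * reg_coeff K \<gamma>0 s"

text \<open>
  The law of the iterate \<open>x\<^sub>s\<close>. The Giry bind expresses that each call of the inner solver uses
  fresh randomness: conditionally on \<open>x\<^sub>s\<close>, the next iterate has law \<open>A F\<^sup>s x\<^sub>s\<close>, where \<open>F\<^sup>s\<close> is the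
  objective of stage \<open>s\<close>.
\<close>

primrec AdaptRdct_C ::
  "'a::real_normed_vector rand_alg \<Rightarrow> ('a \<Rightarrow> real) \<Rightarrow> 'a \<Rightarrow> real \<Rightarrow> real \<Rightarrow> nat \<Rightarrow> 'a measure" where
  "AdaptRdct_C A F x0 K \<gamma>0 0 = return borel x0"
| "AdaptRdct_C A F x0 K \<gamma>0 (Suc s) =
     AdaptRdct_C A F x0 K \<gamma>0 s \<bind> A (reg_obj F x0 (reg_coeff K \<gamma>0 s))"

end

theory Submission
  imports Defs
begin

text \<open>
  Write \<open>F\<^sub>s\<close> for the objective of stage \<open>s\<close>, \<open>\<gamma>\<^sub>s = q\<^sup>s \<gamma>\<^sub>0\<close> with \<open>q = sqrt K\<close> for its coefficient and
  \<open>m\<^sub>s\<close> for its minimum, and follow the expected gap \<open>D\<^sub>s = \<E>[F\<^sub>s(x\<^sub>s) - m\<^sub>s]\<close>. Two things happen to it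
  in each stage. The inner solver contracts it, \<open>\<E>[F\<^sub>s(x\<^sub>s\<^sub>+\<^sub>1) - m\<^sub>s - \<delta>] \<le> K (D\<^sub>s - \<delta>) + E\<close>, and
  this passes from a fixed to a random starting point because the bound is affine in the gap
  (\<open>affine_drift_bind\<close>). Then the objective is exchanged for \<open>F\<^sub>s\<^sub>+\<^sub>1 \<le> F\<^sub>s\<close>, which costs at most
  \<open>m\<^sub>s - m\<^sub>s\<^sub>+\<^sub>1\<close>. Now the minimizers of all the regularized objectives are at least as close to \<open>x\<^sub>0\<close>
  as \<open>x\<^sup>*\<close> is, so this drop is at most \<open>(\<gamma>\<^sub>s - \<gamma>\<^sub>s\<^sub>+\<^sub>1) \<Theta> / 2\<close> (\<open>min_val_reg_obj_decrement\<close>).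

  Hence \<open>D\<^sub>s\<^sub>+\<^sub>1 - \<delta> \<le> K (D\<^sub>s - \<delta>) + E + (1 - q) q\<^sup>s \<gamma>\<^sub>0 \<Theta> / 2\<close>. The solver contracts by \<open>q\<^sup>2\<close>, the
  bias shrinks only by \<open>q\<close>, so the accumulated bias stays a fixed multiple of \<open>q\<^sup>s \<gamma>\<^sub>0 \<Theta>\<close>, and the
  fixed point of \<open>c q = q\<^sup>2 c + (1 - q) / 2\<close> is \<open>c = 1 / (2 q)\<close>. At the end
  \<open>F \<le> F\<^sub>S\<close> and \<open>m\<^sub>S \<le> F(x\<^sup>*) + \<gamma>\<^sub>S \<Theta> / 2\<close>, so that returning to the original objective contributes
  another \<open>q\<^sup>S \<gamma>\<^sub>0 \<Theta> / 2\<close>.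

  Convexity enters through continuity: it makes the objectives measurable and, as the quadratic
  term makes their sublevel sets bounded, lets them attain their minima, without which
  \<open>min_val\<close> would carry no information.
\<close>

section \<open>Minima of the regularized objectives\<close>

lemma min_val_eqI:
  assumes "\<And>x. G z \<le> G x"
  shows "min_val G = G z"
  unfolding min_val_def using assms by (intro Least_equality) auto

text \<open>
  Outside a ball around \<open>x0\<close> the quadratic term alone exceeds \<open>F x0 - F xstar\<close>, so a minimum over
  that compact ball is a global one.
\<close>

lemma reg_obj_attains_min:
  fixes F :: "'a::euclidean_space \<Rightarrow> real"
  assumes "continuous_on UNIV F" and min: "\<And>x. F xstar \<le> F x" and "0 < \<gamma>"
  shows "\<exists>z. \<forall>x. reg_obj F x0 \<gamma> z \<le> reg_obj F x0 \<gamma> x"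
proof -
  define R where "R = sqrt (2 * (F x0 - F xstar) / \<gamma>)"
  have R: "0 \<le> R" "\<gamma> / 2 * R\<^sup>2 = F x0 - F xstar"
    using min[of x0] \<open>0 < \<gamma>\<close> by (simp_all add: R_def)
  have "continuous_on (cball x0 R) (reg_obj F x0 \<gamma>)"
    unfolding reg_obj_def
    by (intro continuous_intros continuous_on_subset[OF assms(1)]) auto
  then obtain z where z: "\<forall>x\<in>cball x0 R. reg_obj F x0 \<gamma> z \<le> reg_obj F x0 \<gamma> x"
    using continuous_attains_inf[of "cball x0 R" "reg_obj F x0 \<gamma>"] \<open>0 \<le> R\<close> by auto
  have "reg_obj F x0 \<gamma> z \<le> reg_obj F x0 \<gamma> x" if "x \<notin> cball x0 R" for x
  proof -
    have "R \<le> norm (x - x0)"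
      using that by (simp add: dist_norm norm_minus_commute)
    then have "\<gamma> / 2 * R\<^sup>2 \<le> \<gamma> / 2 * (norm (x - x0))\<^sup>2"
      using \<open>0 \<le> R\<close> \<open>0 < \<gamma>\<close> by (intro mult_left_mono power_mono) auto
    moreover have "reg_obj F x0 \<gamma> z \<le> F x0"
      using z[rule_format, of x0] \<open>0 \<le> R\<close> by (simp add: reg_obj_def)
    ultimately show ?thesis
      using R(2) min[of x] by (simp add: reg_obj_def)
  qed
  with z show ?thesis by blast
qed

lemma min_val_reg_obj_le:
  fixes F :: "'a::euclidean_space \<Rightarrow> real"
  assumes "continuous_on UNIV F" "\<And>x. F xstar \<le> F x" "0 < \<gamma>"
  shows "min_val (reg_obj F x0 \<gamma>) \<le> reg_obj F x0 \<gamma> x"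
  using reg_obj_attains_min[of F xstar \<gamma> x0] min_val_eqI[of "reg_obj F x0 \<gamma>"] assms by metis

lemma min_le_min_val_reg_obj:
  fixes F :: "'a::euclidean_space \<Rightarrow> real"
  assumes "continuous_on UNIV F" and min: "\<And>x. F xstar \<le> F x" and "0 < \<gamma>"
  shows "F xstar \<le> min_val (reg_obj F x0 \<gamma>)"
proof -
  obtain z where z: "\<forall>x. reg_obj F x0 \<gamma> z \<le> reg_obj F x0 \<gamma> x"
    using reg_obj_attains_min[of F xstar \<gamma> x0] assms by blast
  have "F xstar \<le> reg_obj F x0 \<gamma> z"
    using min[of z] \<open>0 < \<gamma>\<close> by (simp add: reg_obj_def add_increasing2)
  also have "\<dots> = min_val (reg_obj F x0 \<gamma>)"
    using z by (intro min_val_eqI[symmetric]) auto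
  finally show ?thesis .
qed

text \<open>
  Evaluate the larger objective at the minimizer \<open>z\<close> of the smaller one: the values differ by a
  multiple of \<open>\<parallel>z - x0\<parallel>\<^sup>2\<close>. Going from \<open>xstar\<close> to \<open>z\<close> cannot decrease \<open>F\<close>, so it does
  not increase the quadratic term.
\<close>

lemma min_val_reg_obj_decrement:
  fixes F :: "'a::euclidean_space \<Rightarrow> real"
  assumes cont: "continuous_on UNIV F" and min: "\<And>x. F xstar \<le> F x"
    and "0 < \<gamma>'" "\<gamma>' \<le> \<gamma>" and dist: "(norm (x0 - xstar))\<^sup>2 \<le> \<Theta>"
  shows "min_val (reg_obj F x0 \<gamma>) \<le> min_val (reg_obj F x0 \<gamma>') + (\<gamma> - \<gamma>') / 2 * \<Theta>"
proof -
  obtain z where z: "\<forall>x. reg_obj F x0 \<gamma>' z \<le> reg_obj F x0 \<gamma>' x"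
    using reg_obj_attains_min[of F xstar \<gamma>' x0] assms by blast
  have "\<gamma>' / 2 * (norm (z - x0))\<^sup>2 \<le> \<gamma>' / 2 * (norm (xstar - x0))\<^sup>2"
    using z[rule_format, of xstar] min[of z] by (simp add: reg_obj_def)
  then have "(norm (z - x0))\<^sup>2 \<le> (norm (xstar - x0))\<^sup>2"
    using \<open>0 < \<gamma>'\<close> by (simp only: mult_le_cancel_left_pos[of "\<gamma>' / 2"] half_gt_zero)
  also have "\<dots> \<le> \<Theta>"
    using dist by (simp add: norm_minus_commute)
  finally have "(norm (z - x0))\<^sup>2 \<le> \<Theta>" .
  then have "(\<gamma> - \<gamma>') / 2 * (norm (z - x0))\<^sup>2 \<le> (\<gamma> - \<gamma>') / 2 * \<Theta>"
    using \<open>\<gamma>' \<le> \<gamma>\<close> by (intro mult_left_mono) auto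
  moreover have "min_val (reg_obj F x0 \<gamma>) \<le> reg_obj F x0 \<gamma> z"
    using min_val_reg_obj_le[of F xstar \<gamma> x0 z] assms by auto
  moreover have "reg_obj F x0 \<gamma> z = reg_obj F x0 \<gamma>' z + (\<gamma> - \<gamma>') / 2 * (norm (z - x0))\<^sup>2"
    by (simp add: reg_obj_def field_simps)
  moreover have "min_val (reg_obj F x0 \<gamma>') = reg_obj F x0 \<gamma>' z"
    using z by (intro min_val_eqI) auto
  ultimately show ?thesis by linarith
qed

section \<open>Expected decrease from a random starting point\<close>

lemma bind_in_space_prob_algebra:
  assumes M: "M \<in> space (prob_algebra N)" and k: "k \<in> N \<rightarrow>\<^sub>M prob_algebra P"
  shows "M \<bind> k \<in> space (prob_algebra P)"
proof -
  interpret prob_space M using M by (simp add: space_prob_algebra)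
  have sM: "sets M = sets N" using M by (simp add: space_prob_algebra)
  have k': "k \<in> M \<rightarrow>\<^sub>M subprob_algebra P"
    using measurable_prob_algebraD[OF k] by (simp cong: measurable_cong_sets add: sM)
  have *: "\<And>x. x \<in> space M \<Longrightarrow> k x \<in> space (prob_algebra P)"
    using measurable_space[OF k] sets_eq_imp_space_eq[OF sM] by simp
  have "prob_space (M \<bind> k)"
    using * by (intro prob_space_bind[OF _ k']) (auto simp: space_prob_algebra)
  moreover have "sets (M \<bind> k) = sets P"
    using * not_empty by (intro sets_bind) (auto simp: space_prob_algebra)
  ultimately show ?thesis by (simp add: space_prob_algebra)
qed

text \<open>
  The tower rule for a Lyapunov-type bound. For nonnegative \<open>H\<close> the iterated integral can be taken
  in the extended nonnegative reals; the constant \<open>c\<close> may be negative, but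
  \<open>K * H x + c\<close> is not, as it dominates a nonnegative integral.
\<close>

lemma affine_drift_bind:
  fixes H :: "'a \<Rightarrow> real"
  assumes M: "M \<in> space (prob_algebra N)" and k: "k \<in> N \<rightarrow>\<^sub>M prob_algebra N"
    and H: "H \<in> borel_measurable N" "\<And>x. 0 \<le> H x" and int: "integrable M H"
    and int_k: "\<And>x. x \<in> space N \<Longrightarrow> integrable (k x) H"
    and drift: "\<And>x. x \<in> space N \<Longrightarrow> (\<integral>y. H y \<partial>k x) \<le> K * H x + c"
  shows "integrable (M \<bind> k) H"
    and "(\<integral>x. H x \<partial>(M \<bind> k)) \<le> K * (\<integral>x. H x \<partial>M) + c"
proof -
  interpret prob_space M using M by (simp add: space_prob_algebra)
  have sM: "sets M = sets N" using M by (simp add: space_prob_algebra)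
  have spM: "space M = space N" using sM by (rule sets_eq_imp_space_eq)
  have k': "k \<in> M \<rightarrow>\<^sub>M subprob_algebra N"
    using measurable_prob_algebraD[OF k] by (simp cong: measurable_cong_sets add: sM)
  have meas: "H \<in> borel_measurable (M \<bind> k)"
    using H(1) bind_in_space_prob_algebra[OF M k]
    by (simp add: space_prob_algebra cong: measurable_cong_sets)
  have nonneg: "0 \<le> K * H x + c" if "x \<in> space N" for x
    using H(2) by (intro order_trans[OF _ drift[OF that]] integral_nonneg_AE AE_I2)
  have int': "integrable M (\<lambda>x. K * H x + c)"
    using int by simp
  have "(\<integral>\<^sup>+x. H x \<partial>(M \<bind> k)) = (\<integral>\<^sup>+x. \<integral>\<^sup>+y. H y \<partial>k x \<partial>M)"
    using H(1) k' by (intro nn_integral_bind) auto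
  also have "\<dots> \<le> (\<integral>\<^sup>+x. ennreal (K * H x + c) \<partial>M)"
    using int_k drift H(2)
    by (intro nn_integral_mono) (simp add: nn_integral_eq_integral spM ennreal_leI)
  also have "\<dots> = ennreal (\<integral>x. K * H x + c \<partial>M)"
    using nonneg by (intro nn_integral_eq_integral int' AE_I2) (simp add: spM)
  also have "(\<integral>x. K * H x + c \<partial>M) = K * (\<integral>x. H x \<partial>M) + c"
    using int by (simp add: prob_space)
  finally have le: "(\<integral>\<^sup>+x. H x \<partial>(M \<bind> k)) \<le> ennreal (K * (\<integral>x. H x \<partial>M) + c)" .
  show int_bind: "integrable (M \<bind> k) H"
    using meas H(2) le le_less_trans[OF le ennreal_less_top]
    by (intro integrableI_nonneg) auto
  have "0 \<le> (\<integral>x. K * H x + c \<partial>M)"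
    using nonneg by (intro integral_nonneg_AE AE_I2) (simp add: spM)
  then have "0 \<le> K * (\<integral>x. H x \<partial>M) + c"
    using int by (simp add: prob_space)
  with le show "(\<integral>x. H x \<partial>(M \<bind> k)) \<le> K * (\<integral>x. H x \<partial>M) + c"
    using nn_integral_eq_integral[OF int_bind] H(2) by simp
qed

section \<open>The gap along the stages\<close>

lemma reg_coeff_eq: "reg_coeff K \<gamma>0 s = sqrt K ^ s * \<gamma>0"
  by (induction s) auto

text \<open>
  The gap is measured against the objective of the stage that is about to start. Then one stage is a
  call of the solver followed by an exchange of objectives, and the induction can begin at
  \<open>s = 0\<close>, where nothing has been run. The solver bound concerns \<open>H x - \<delta>\<close>, whose sign is unknown;
  shifting \<open>\<delta>\<close> into the constant gives the affine bound on the nonnegative gap \<open>H\<close> that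
  \<open>affine_drift_bind\<close> needs. Integrability survives the exchange of objectives since the new gap
  lies between \<open>0\<close> and the old one plus a constant.
\<close>

lemma AdaptRdct_C_gap:
  fixes F :: "'a::euclidean_space \<Rightarrow> real" and x0 :: 'a and \<gamma>0 K :: real
  defines "G \<equiv> \<lambda>s. reg_obj F x0 (reg_coeff K \<gamma>0 s)"
  assumes cont: "continuous_on UNIV F" and min: "\<And>x. F xstar \<le> F x"
    and \<Delta>: "F x0 - F xstar \<le> \<Delta>" and \<Theta>: "(norm (x0 - xstar))\<^sup>2 \<le> \<Theta>"
    and K: "0 < K" "K < 1" and "0 \<le> E" "0 < \<gamma>0"
    and zood: "ZOOD A (range G) \<delta> K E"
  shows "AdaptRdct_C A F x0 K \<gamma>0 s \<in> space (prob_algebra borel) \<and>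
    integrable (AdaptRdct_C A F x0 K \<gamma>0 s) (\<lambda>x. G s x - min_val (G s)) \<and>
    (\<integral>x. (G s x - min_val (G s)) \<partial>AdaptRdct_C A F x0 K \<gamma>0 s)
      \<le> \<delta> + K ^ s * (\<Delta> - \<delta>) + sqrt K ^ s / (2 * sqrt K) * \<gamma>0 * \<Theta> + E / (1 - K)"
proof (induction s)
  case 0
  have \<Theta>_nonneg: "0 \<le> \<Theta>"
    using \<Theta> by (rule order_trans[rotated]) simp
  have meas: "(\<lambda>x. G 0 x - min_val (G 0)) \<in> borel_measurable borel"
    unfolding G_def reg_obj_def
    by (intro borel_measurable_continuous_onI continuous_intros cont)
  have "G 0 x0 - min_val (G 0) \<le> \<Delta>"
    using min_le_min_val_reg_obj[of F xstar \<gamma>0 x0] cont min \<Delta> \<open>0 < \<gamma>0\<close>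
    by (auto simp: G_def reg_obj_def)
  moreover have "0 \<le> 1 / (2 * sqrt K) * \<gamma>0 * \<Theta>" "0 \<le> E / (1 - K)"
    using K \<open>0 < \<gamma>0\<close> \<open>0 \<le> E\<close> \<Theta>_nonneg by auto
  moreover have "integrable (return borel x0) (\<lambda>x. G 0 x - min_val (G 0))"
    using meas by (intro integrableI_bounded) (auto simp: nn_integral_return)
  ultimately show ?case
    using meas by (simp add: integral_return space_prob_algebra prob_space_return)
next
  case (Suc s)
  define q where "q = sqrt K"
  have q: "0 < q" "q < 1" "K = q * q" using K by (auto simp: q_def)
  define M where "M = AdaptRdct_C A F x0 K \<gamma>0 s"
  define H where "H = (\<lambda>x. G s x - min_val (G s))"
  define H' where "H' = (\<lambda>x. G (Suc s) x - min_val (G (Suc s)))"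
  define bias where "bias = (1 - q) / 2 * q ^ s * \<gamma>0 * \<Theta>"
  have coeff: "0 < reg_coeff K \<gamma>0 s" "0 < reg_coeff K \<gamma>0 (Suc s)"
      "reg_coeff K \<gamma>0 (Suc s) \<le> reg_coeff K \<gamma>0 s"
    using q(1,2) \<open>0 < \<gamma>0\<close> unfolding reg_coeff_eq q_def[symmetric]
    by (auto intro!: mult_left_le_one_le)
  have kernel: "A (G s) \<in> borel \<rightarrow>\<^sub>M prob_algebra borel"
    and solver: "\<And>x. integrable (A (G s) x) (\<lambda>x'. H x' - \<delta>)"
      "\<And>x. (\<integral>x'. (H x' - \<delta>) \<partial>A (G s) x) \<le> K * (H x - \<delta>) + E"
    using zood by (auto simp: ZOOD_def H_def)
  have M: "M \<in> space (prob_algebra borel)" and "integrable M H"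
    using Suc.IH by (auto simp: M_def H_def)
  have meas: "H \<in> borel_measurable borel" "H' \<in> borel_measurable borel"
    unfolding H_def H'_def G_def reg_obj_def
    by (intro borel_measurable_continuous_onI continuous_intros cont)+
  have nonneg: "0 \<le> H x" "0 \<le> H' x" for x
    using min_val_reg_obj_le[of F xstar _ x0 x] cont min coeff(1,2)
    by (auto simp: H_def H'_def G_def)
  have prob: "prob_space (A (G s) x)" for x
    using measurable_space[OF kernel, of x] by (simp add: space_prob_algebra)
  have int: "integrable (A (G s) x) H" for x
  proof -
    interpret prob_space "A (G s) x" by (rule prob)
    have "integrable (A (G s) x) (\<lambda>x'. (H x' - \<delta>) + \<delta>)"
      by (intro Bochner_Integration.integrable_add solver(1)) simp
    then show ?thesis by simp
  qed
  have drift: "(\<integral>x'. H x' \<partial>A (G s) x) \<le> K * H x + ((1 - K) * \<delta> + E)" for x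
  proof -
    interpret prob_space "A (G s) x" by (rule prob)
    have "(\<integral>x'. (H x' - \<delta>) \<partial>A (G s) x) = (\<integral>x'. H x' \<partial>A (G s) x) - \<delta>"
      using int by (simp add: prob_space)
    with solver(2)[of x] show ?thesis by (simp add: algebra_simps)
  qed
  note step = affine_drift_bind[OF M kernel meas(1) nonneg(1) \<open>integrable M H\<close> int drift]
  have next_iterate: "AdaptRdct_C A F x0 K \<gamma>0 (Suc s) = M \<bind> A (G s)"
    by (simp add: M_def G_def)
  have M': "M \<bind> A (G s) \<in> space (prob_algebra borel)"
    using M kernel by (rule bind_in_space_prob_algebra)
  interpret M': prob_space "M \<bind> A (G s)"
    using M' by (simp add: space_prob_algebra)
  have exchange: "H' x \<le> H x + bias" for x
  proof -
    have "G (Suc s) x \<le> G s x"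
      using coeff(3) by (simp add: G_def reg_obj_def mult_right_mono del: reg_coeff.simps)
    moreover have "min_val (G s) \<le> min_val (G (Suc s)) + bias"
      using min_val_reg_obj_decrement[of F xstar "reg_coeff K \<gamma>0 (Suc s)" "reg_coeff K \<gamma>0 s" x0 \<Theta>]
        cont min coeff \<Theta>
      by (simp add: G_def bias_def reg_coeff_eq q_def algebra_simps diff_divide_distrib
          del: reg_coeff.simps)
    ultimately show ?thesis by (simp add: H_def H'_def)
  qed
  have int_bias: "integrable (M \<bind> A (G s)) (\<lambda>x. H x + bias)"
    using step(1) by simp
  have int': "integrable (M \<bind> A (G s)) H'"
  proof (rule Bochner_Integration.integrable_bound[OF int_bias])
    show "H' \<in> borel_measurable (M \<bind> A (G s))"
      using meas(2) M' by (simp add: space_prob_algebra cong: measurable_cong_sets)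
    show "AE x in M \<bind> A (G s). norm (H' x) \<le> norm (H x + bias)"
      using nonneg(2) order_trans[OF exchange abs_ge_self] by (intro AE_I2) simp
  qed
  have "(\<integral>x. H' x \<partial>(M \<bind> A (G s))) \<le> (\<integral>x. H x + bias \<partial>(M \<bind> A (G s)))"
    using int' int_bias exchange by (rule integral_mono)
  also have "\<dots> = (\<integral>x. H x \<partial>(M \<bind> A (G s))) + bias"
    using step(1) by (simp add: M'.prob_space)
  also have "\<dots> \<le> K * (\<integral>x. H x \<partial>M) + ((1 - K) * \<delta> + E) + bias"
    using step(2) by simp
  also have "\<dots> \<le> K * (\<delta> + K ^ s * (\<Delta> - \<delta>) + q ^ s / (2 * q) * \<gamma>0 * \<Theta> + E / (1 - K))
      + ((1 - K) * \<delta> + E) + bias"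
    using Suc.IH K by (simp add: M_def H_def q_def)
  also have "\<dots> = \<delta> + K ^ Suc s * (\<Delta> - \<delta>) + q ^ Suc s / (2 * q) * \<gamma>0 * \<Theta> + E / (1 - K)"
  proof -
    \<comment> \<open>Both error terms are fixed points of their recurrences: that of \<open>E\<close> exactly, that of the
      bias after division by \<open>q ^ s\<close>.\<close>
    have "K * (E / (1 - K)) + E = E / (1 - K)"
      using K by (simp add: field_simps)
    moreover have "K * (q ^ s / (2 * q) * \<gamma>0 * \<Theta>) + bias = q ^ Suc s / (2 * q) * \<gamma>0 * \<Theta>"
      using q(1) unfolding bias_def q(3) by (simp add: field_simps)
    ultimately show ?thesis by (simp add: algebra_simps)
  qed
  finally show ?case
    using int' M' by (simp add: next_iterate H'_def q_def del: AdaptRdct_C.simps)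
qed

theorem theorem1:
  fixes fi :: "nat \<Rightarrow> real ^ 'd \<Rightarrow> real"
    and f r F :: "real ^ 'd \<Rightarrow> real"
    and n S :: nat
    and L \<Delta> \<Theta> \<delta> K E \<gamma>0 :: real
    and xstar x0 :: "real ^ 'd"
    and A :: "(real ^ 'd) rand_alg"
  assumes "n \<ge> 1"
    and "\<And>i. i \<in> {1..n} \<Longrightarrow> L_smooth L (fi i)"
    and "\<And>x. f x = 1 / real n * (\<Sum>i = 1..n. fi i x)"
    and "convex_on UNIV f"
    and "convex_on UNIV r"
    and "\<And>x. F x = f x + r x"
    and "\<And>x. F xstar \<le> F x"
    and "F x0 - F xstar \<le> \<Delta>"
    and "(norm (x0 - xstar))\<^sup>2 \<le> \<Theta>"
    and "0 < K" "K < 1" "0 \<le> E" "0 < \<gamma>0"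
    and "ZOOD A (range (\<lambda>s. reg_obj F x0 (reg_coeff K \<gamma>0 s))) \<delta> K E"
  shows "integrable (AdaptRdct_C A F x0 K \<gamma>0 S) (\<lambda>x. F x - F xstar) \<and>
    (\<integral>x. (F x - F xstar) \<partial>AdaptRdct_C A F x0 K \<gamma>0 S)
      \<le> \<delta> + K ^ S * (\<Delta> - \<delta>) + (1 / 2 + 2 / sqrt K) * K powr (real S / 2) * \<gamma>0 * \<Theta>
         + E / (1 - K)"
proof -
  define q where "q = sqrt K"
  define M where "M = AdaptRdct_C A F x0 K \<gamma>0 S"
  define G where "G = reg_obj F x0 (reg_coeff K \<gamma>0 S)"
  have q: "0 < q" using \<open>0 < K\<close> by (simp add: q_def)
  have coeff: "0 < reg_coeff K \<gamma>0 S" "reg_coeff K \<gamma>0 S = q ^ S * \<gamma>0"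
    using \<open>0 < K\<close> \<open>0 < \<gamma>0\<close> by (auto simp: reg_coeff_eq q_def)
  have "F = (\<lambda>x. f x + r x)" using assms(6) by auto
  then have "convex_on UNIV F" using assms(4,5) by (simp add: convex_on_add)
  then have cont: "continuous_on UNIV F" by (simp add: convex_on_continuous)
  have M: "M \<in> space (prob_algebra borel)" and int: "integrable M (\<lambda>x. G x - min_val G)"
    and gap: "(\<integral>x. (G x - min_val G) \<partial>M)
      \<le> \<delta> + K ^ S * (\<Delta> - \<delta>) + q ^ S / (2 * q) * \<gamma>0 * \<Theta> + E / (1 - K)"
    using AdaptRdct_C_gap[where s = S, OF cont assms(7-14)] by (auto simp: M_def G_def q_def)
  interpret prob_space M using M by (simp add: space_prob_algebra)
  have exchange: "F x - F xstar \<le> G x - min_val G + q ^ S / 2 * \<gamma>0 * \<Theta>" for x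
  proof -
    have "F x \<le> G x" using coeff(1) by (simp add: G_def reg_obj_def)
    moreover have "min_val G \<le> reg_obj F x0 (reg_coeff K \<gamma>0 S) xstar"
      unfolding G_def using cont assms(7) coeff(1) by (rule min_val_reg_obj_le)
    moreover have "reg_coeff K \<gamma>0 S / 2 * (norm (xstar - x0))\<^sup>2 \<le> reg_coeff K \<gamma>0 S / 2 * \<Theta>"
      using coeff(1) assms(9) by (intro mult_left_mono) (auto simp: norm_minus_commute)
    ultimately show ?thesis by (simp add: reg_obj_def coeff(2))
  qed
  have int_bias: "integrable M (\<lambda>x. G x - min_val G + q ^ S / 2 * \<gamma>0 * \<Theta>)"
    by (intro Bochner_Integration.integrable_add int) simp
  have int_F: "integrable M (\<lambda>x. F x - F xstar)"
  proof (rule Bochner_Integration.integrable_bound[OF int_bias])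
    have "(\<lambda>x. F x - F xstar) \<in> borel_measurable borel"
      by (intro borel_measurable_continuous_onI continuous_intros cont)
    then show "(\<lambda>x. F x - F xstar) \<in> borel_measurable M"
      using M by (simp add: space_prob_algebra cong: measurable_cong_sets)
    show "AE x in M. norm (F x - F xstar) \<le> norm (G x - min_val G + q ^ S / 2 * \<gamma>0 * \<Theta>)"
      using assms(7) order_trans[OF exchange abs_ge_self] by (intro AE_I2) simp
  qed
  have "(\<integral>x. (F x - F xstar) \<partial>M) \<le> (\<integral>x. G x - min_val G + q ^ S / 2 * \<gamma>0 * \<Theta> \<partial>M)"
    using int_F int_bias exchange by (rule integral_mono)
  also have "\<dots> = (\<integral>x. G x - min_val G \<partial>M) + q ^ S / 2 * \<gamma>0 * \<Theta>"
    by (subst Bochner_Integration.integral_add[OF int]) (simp_all add: prob_space)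
  also have "\<dots> \<le> \<delta> + K ^ S * (\<Delta> - \<delta>) + (1 / 2 + 1 / (2 * q)) * (q ^ S * \<gamma>0 * \<Theta>) + E / (1 - K)"
  proof -
    have "(1 / 2 + 1 / (2 * q)) * (q ^ S * \<gamma>0 * \<Theta>)
        = q ^ S / 2 * \<gamma>0 * \<Theta> + q ^ S / (2 * q) * \<gamma>0 * \<Theta>"
      by (simp add: ring_distribs)
    with gap show ?thesis by linarith
  qed
  also have "\<dots> \<le> \<delta> + K ^ S * (\<Delta> - \<delta>) + (1 / 2 + 2 / q) * (q ^ S * \<gamma>0 * \<Theta>) + E / (1 - K)"
  proof -
    have "0 \<le> \<Theta>" using assms(9) by (rule order_trans[rotated]) simp
    moreover have "1 / (2 * q) \<le> 2 / q" using q by (simp add: field_simps)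
    ultimately have "(1 / 2 + 1 / (2 * q)) * (q ^ S * \<gamma>0 * \<Theta>) \<le> (1 / 2 + 2 / q) * (q ^ S * \<gamma>0 * \<Theta>)"
      using q \<open>0 < \<gamma>0\<close> by (intro mult_right_mono) auto
    then show ?thesis by simp
  qed
  also have "q ^ S = K powr (real S / 2)"
  proof -
    have "q ^ S = (K powr (1 / 2)) powr real S"
      using \<open>0 < K\<close> q by (simp add: q_def powr_half_sqrt powr_realpow)
    then show ?thesis by (simp add: powr_powr)
  qed
  finally show ?thesis
    using int_F by (simp add: M_def q_def mult.assoc)
qed

end
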